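(* Let $\psi$ be a real-valued graph parameter such that $\psi(H)=1$ for every graph $H$ with no edges and $\psi(H)\geq\chi(H)$ for every graph $H$, where $\chi$ denotes the chromatic number. Let $\alpha\geq 0$ be a real number. Let $G$ be a graph, let $\lambda_n$ be the least eigenvalue of the adjacency matrix of $G$, and let $d$ be the average degree of $G$. Then \[L_{\psi,\alpha}(G)\ \geq\ \frac{d-\lambda_n}{2\alpha-\lambda_n}.\]
   Context: Graphs are finite, simple and undirected. For a subset $S$ of the vertices of $G$, $G[S]$ denotes the induced subgraph of $G$ on $S$. For a real number $c$, a graph $H$ has a $c$-vertex cover if there exists a cover $E(H)=\bigcup_{i\in V(H)}E_i$ of its edge set such that for all $i\in V(H)$, $E_i\subset\{e\in E(H): i\in e\}$ (every edge in $E_i$ is incident with $i$) and $|E_i|\leq c$. For a graph parameter $\psi$ as in the claim and a real $\alpha\ge 0$, $L_{\psi,\alpha}(G)$ denotes the minimal $k$ such that there exist $k$ subsets $S_1,\ldots,S_k$ of the vertex set of $G$ such that: (i) for all $i=1,\ldots,k$, the graph $G[S_i]$ has an $\alpha\cdot\psi(G[S_i])$-vertex cover; and (ii) for every vertex $v$ of $G$, \[\sum_{i\,:\,v\in S_i}\frac{1}{\psi(G[S_i])}\ \geq\ 1.\] *)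

theory Defs
  imports Complex_Main "Jordan_Normal_Form.Spectral_Radius"
begin

record 'a ugraph =
  verts :: "'a set"
  edges :: "'a set set"

definition simple_graph :: "'a ugraph \<Rightarrow> bool" where
  "simple_graph G \<longleftrightarrow> finite (verts G) \<and> (\<forall>e\<in>edges G. e \<subseteq> verts G \<and> card e = 2)"

definition induced :: "'a ugraph \<Rightarrow> 'a set \<Rightarrow> 'a ugraph" where
  "induced G S = \<lparr>verts = S, edges = {e \<in> edges G. e \<subseteq> S}\<rparr>"

definition graph_iso :: "'a ugraph \<Rightarrow> 'a ugraph \<Rightarrow> bool" where
  "graph_iso G H \<longleftrightarrow>
    (\<exists>f. bij_betw f (verts G) (verts H) \<and> edges H = (\<lambda>e. f ` e) ` edges G)"

definition graph_parameter :: "('a ugraph \<Rightarrow> real) \<Rightarrow> bool" where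
  "graph_parameter \<psi> \<longleftrightarrow>
    (\<forall>G H. simple_graph G \<longrightarrow> simple_graph H \<longrightarrow> graph_iso G H \<longrightarrow> \<psi> G = \<psi> H)"

definition proper_colouring :: "'a ugraph \<Rightarrow> nat \<Rightarrow> ('a \<Rightarrow> nat) \<Rightarrow> bool" where
  "proper_colouring G k c \<longleftrightarrow>
    (\<forall>v\<in>verts G. c v < k) \<and> (\<forall>u v. {u, v} \<in> edges G \<longrightarrow> c u \<noteq> c v)"

definition chromatic_number :: "'a ugraph \<Rightarrow> nat" where
  "chromatic_number G = (LEAST k. \<exists>c. proper_colouring G k c)"

definition vertex_degree :: "'a ugraph \<Rightarrow> 'a \<Rightarrow> nat" where
  "vertex_degree G v = card {e \<in> edges G. v \<in> e}"

definition average_degree :: "'a ugraph \<Rightarrow> real" where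
  "average_degree G = (\<Sum>v\<in>verts G. real (vertex_degree G v)) / real (card (verts G))"

text \<open>The list fixes the order of the rows and columns; it is meant to enumerate the vertices of
  the graph without repetition.\<close>

definition adjacency_mat :: "'a ugraph \<Rightarrow> 'a list \<Rightarrow> real mat" where
  "adjacency_mat G vs =
    mat (length vs) (length vs) (\<lambda>(i, j). if {vs ! i, vs ! j} \<in> edges G then 1 else 0)"

text \<open>Only real eigenvalues are in the spectrum of a real matrix, but for a symmetric matrix these
  are all of its complex eigenvalues.\<close>

definition least_eigenvalue :: "real mat \<Rightarrow> real" where
  "least_eigenvalue A = Min (spectrum A)"

definition has_vertex_cover :: "real \<Rightarrow> 'a ugraph \<Rightarrow> bool" where
  "has_vertex_cover c H \<longleftrightarrow>
    (\<exists>E :: 'a \<Rightarrow> 'a set set.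
      edges H = (\<Union>i\<in>verts H. E i) \<and>
      (\<forall>i\<in>verts H. E i \<subseteq> {e \<in> edges H. i \<in> e} \<and> real (card (E i)) \<le> c))"

text \<open>The subsets form an indexed family, so repetitions are allowed. A family always exists if
  \<open>\<alpha> \<ge> 0\<close> and \<open>\<psi>\<close> is 1 on edgeless graphs: take all singletons.\<close>

definition L :: "('a ugraph \<Rightarrow> real) \<Rightarrow> real \<Rightarrow> 'a ugraph \<Rightarrow> nat" where
  "L \<psi> \<alpha> G = (LEAST k. \<exists>S :: nat \<Rightarrow> 'a set.
      (\<forall>i<k. S i \<subseteq> verts G \<and> has_vertex_cover (\<alpha> * \<psi> (induced G (S i))) (induced G (S i))) \<and>
      (\<forall>v\<in>verts G. (\<Sum>i | i < k \<and> v \<in> S i. 1 / \<psi> (induced G (S i))) \<ge> 1))"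

end

theory Submission
  imports Defs "HOL-Analysis.Function_Topology"
begin

text \<open>
  The bound is the one of Hoffman's type that one gets by spreading the all-ones vector over the
  sets of the family. Write \<open>\<lambda>\<close> for the least eigenvalue of the adjacency matrix \<open>A\<close>, \<open>n\<close> for the
  number of vertices and \<open>\<psi>\<^sub>i\<close> for \<open>\<psi>\<close> of the subgraph induced on \<open>S\<^sub>i\<close>. As
  the numbers \<open>1/\<psi>\<^sub>i\<close> over the sets containing a vertex sum to at least \<open>1\<close>, they can be scaled down at
  each vertex separately. This yields vectors \<open>f\<^sub>1, \<dots>, f\<^sub>k\<close> with sum \<open>1\<close>, where \<open>f\<^sub>i\<close> is supported on
  \<open>S\<^sub>i\<close> and has entries between \<open>0\<close> and \<open>1/\<psi>\<^sub>i\<close> (\<open>cover_family_weights\<close>).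

  Since \<open>A - \<lambda>I\<close> is positive semidefinite (\<open>least_eigenvalue_adj_le\<close>), its quadratic form is convex,
  so its value \<open>n (d - \<lambda>)\<close> at the vector \<open>1\<close> is at most \<open>k\<close> times the sum of its values at the
  \<open>f\<^sub>i\<close> (\<open>bilin_psd_sum_le\<close>). Two estimates bound that sum by \<open>(2\<alpha> - \<lambda>) n\<close>:

  \<^item> The vertex cover orients the edges inside \<open>S\<^sub>i\<close> so that every vertex is charged at most \<open>\<alpha>\<psi>\<^sub>i\<close> of
    them. The edge \<open>uv\<close>, if charged to \<open>u\<close>, costs \<open>2 f\<^sub>i(u) f\<^sub>i(v) \<le> 2 f\<^sub>i(u)/\<psi>\<^sub>i\<close>, so that \<open>\<psi>\<^sub>i\<close> cancels
    and \<open>\<langle>f\<^sub>i, A f\<^sub>i\<rangle> \<le> 2\<alpha> \<Sum>f\<^sub>i\<close> (\<open>bilin_adj_vertex_cover_le\<close>).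

  \<^item> Because \<open>\<psi>\<^sub>i \<ge> 1\<close>, the entries of \<open>f\<^sub>i\<close> are at most \<open>1\<close>, hence \<open>\<parallel>f\<^sub>i\<parallel>\<^sup>2 \<le> \<Sum>f\<^sub>i\<close>; moreover \<open>\<lambda> \<le> 0\<close>.

  Dividing by \<open>n\<close> gives \<open>d - \<lambda> \<le> k (2\<alpha> - \<lambda>)\<close> (\<open>cover_family_size_ge\<close>). Here \<open>\<psi> \<ge> 1\<close>
  holds because \<open>\<psi> \<ge> \<chi>\<close>, except on the graph without vertices, which has no edges (\<open>graph_parameter_ge_1\<close>).
\<close>

section \<open>Bilinear forms indexed by a finite set\<close>

definition bilin :: "'v set \<Rightarrow> ('v \<Rightarrow> 'v \<Rightarrow> real) \<Rightarrow> ('v \<Rightarrow> real) \<Rightarrow> ('v \<Rightarrow> real) \<Rightarrow> real" where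
  "bilin V a x y = (\<Sum>u\<in>V. \<Sum>v\<in>V. a u v * x u * y v)"

lemma bilin_add_left: "bilin V a (\<lambda>v. x v + x' v) y = bilin V a x y + bilin V a x' y"
  by (simp add: bilin_def algebra_simps sum.distrib)

lemma bilin_add_right: "bilin V a x (\<lambda>v. y v + y' v) = bilin V a x y + bilin V a x y'"
  by (simp add: bilin_def algebra_simps sum.distrib)

lemma bilin_diff_left: "bilin V a (\<lambda>v. x v - x' v) y = bilin V a x y - bilin V a x' y"
  by (simp add: bilin_def algebra_simps sum_subtractf)

lemma bilin_diff_right: "bilin V a x (\<lambda>v. y v - y' v) = bilin V a x y - bilin V a x y'"
  by (simp add: bilin_def algebra_simps sum_subtractf)

lemma bilin_scale_left: "bilin V a (\<lambda>v. c * x v) y = c * bilin V a x y"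
  by (simp add: bilin_def sum_distrib_left mult_ac)

lemma bilin_scale_right: "bilin V a x (\<lambda>v. c * y v) = c * bilin V a x y"
  by (simp add: bilin_def sum_distrib_left mult_ac)

lemma bilin_zero_left: "bilin V a (\<lambda>v. 0) y = 0"
  by (simp add: bilin_def)

lemma bilin_zero_right: "bilin V a x (\<lambda>v. 0) = 0"
  by (simp add: bilin_def)

lemma bilin_sum_left: "bilin V a (\<lambda>v. \<Sum>i\<in>I. f i v) y = (\<Sum>i\<in>I. bilin V a (f i) y)"
  by (induction I rule: infinite_finite_induct) (simp_all add: bilin_zero_left bilin_add_left)

lemma bilin_sum_right: "bilin V a x (\<lambda>v. \<Sum>i\<in>I. f i v) = (\<Sum>i\<in>I. bilin V a x (f i))"
  by (induction I rule: infinite_finite_induct) (simp_all add: bilin_zero_right bilin_add_right)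

lemma bilin_cong:
  assumes "\<And>v. v \<in> V \<Longrightarrow> x v = x' v" "\<And>v. v \<in> V \<Longrightarrow> y v = y' v"
  shows "bilin V a x y = bilin V a x' y'"
  unfolding bilin_def by (intro sum.cong refl) (simp add: assms)

lemma bilin_shift:
  assumes "finite V"
  shows "bilin V (\<lambda>u v. a u v - (if u = v then m else 0)) x x = bilin V a x x - m * (\<Sum>v\<in>V. (x v)\<^sup>2)"
proof -
  have "bilin V (\<lambda>u v. a u v - (if u = v then m else 0)) x x
      = (\<Sum>u\<in>V. \<Sum>v\<in>V. a u v * x u * x v - (if u = v then m * x u * x v else 0))"
    unfolding bilin_def by (intro sum.cong refl) (auto simp: algebra_simps)
  also have "\<dots> = bilin V a x x - (\<Sum>u\<in>V. m * (x u)\<^sup>2)"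
    using assms by (simp add: bilin_def sum_subtractf sum.delta power2_eq_square mult.assoc)
  finally show ?thesis by (simp add: sum_distrib_left)
qed

lemma bilin_unit_right:
  assumes "finite V" "w \<in> V"
  shows "bilin V a x (\<lambda>v. if v = w then 1 else 0) = (\<Sum>u\<in>V. a u w * x u)"
proof -
  have "bilin V a x (\<lambda>v. if v = w then 1 else 0) = (\<Sum>u\<in>V. \<Sum>v\<in>V. if v = w then a u v * x u else 0)"
    unfolding bilin_def by (intro sum.cong refl) auto
  then show ?thesis using assms by (simp add: sum.delta)
qed

lemma bilin_swap:
  assumes "\<And>u v. u \<in> V \<Longrightarrow> v \<in> V \<Longrightarrow> a u v = a v u"
  shows "bilin V a x y = bilin V a y x"
proof -
  have "bilin V a x y = (\<Sum>v\<in>V. \<Sum>u\<in>V. a u v * x u * y v)"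
    unfolding bilin_def by (rule sum.swap)
  also have "\<dots> = bilin V a y x"
    unfolding bilin_def using assms by (intro sum.cong refl) (simp add: mult_ac)
  finally show ?thesis .
qed

text \<open>Convexity of a positive semidefinite form: the difference of the two sides, doubled, is the sum
  of the form over all differences \<open>f\<^sub>i - f\<^sub>j\<close>.\<close>

lemma bilin_psd_sum_le:
  fixes f :: "'i \<Rightarrow> 'v \<Rightarrow> real"
  assumes psd: "\<And>y. 0 \<le> bilin V b y y"
  shows "bilin V b (\<lambda>v. \<Sum>i\<in>I. f i v) (\<lambda>v. \<Sum>i\<in>I. f i v)
    \<le> real (card I) * (\<Sum>i\<in>I. bilin V b (f i) (f i))"
proof -
  let ?q = "\<lambda>i. bilin V b (f i) (f i)"
  let ?F = "bilin V b (\<lambda>v. \<Sum>i\<in>I. f i v) (\<lambda>v. \<Sum>i\<in>I. f i v)"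
  have F: "?F = (\<Sum>i\<in>I. \<Sum>j\<in>I. bilin V b (f i) (f j))"
    by (simp add: bilin_sum_left bilin_sum_right)
  have F': "?F = (\<Sum>i\<in>I. \<Sum>j\<in>I. bilin V b (f j) (f i))"
    unfolding F by (rule sum.swap)
  have "0 \<le> (\<Sum>i\<in>I. \<Sum>j\<in>I. bilin V b (\<lambda>v. f i v - f j v) (\<lambda>v. f i v - f j v))"
    by (intro sum_nonneg psd)
  also have "\<dots> = (\<Sum>i\<in>I. \<Sum>j\<in>I. ?q i + ?q j - bilin V b (f i) (f j) - bilin V b (f j) (f i))"
    by (intro sum.cong refl) (simp add: bilin_diff_left bilin_diff_right)
  also have "\<dots> = 2 * (real (card I) * (\<Sum>i\<in>I. ?q i)) - 2 * ?F"
    unfolding sum.distrib sum_subtractf F[symmetric] F'[symmetric]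
    by (simp add: sum_distrib_left)
  finally show ?thesis by simp
qed

section \<open>The least eigenvalue of a symmetric matrix\<close>

text \<open>The first-order condition at a minimum, for a quadratic polynomial vanishing at \<open>0\<close>.\<close>

lemma linear_coeff_zero_if_nonneg:
  fixes g c :: real
  assumes "\<And>t. 0 \<le> 2 * t * g + t\<^sup>2 * c"
  shows "g = 0"
proof (rule ccontr)
  assume g: "g \<noteq> 0"
  have "0 \<le> c + 2 * g" "0 \<le> c - 2 * g" using assms[of 1] assms[of "-1"] by auto
  then have c: "c \<ge> 0" by simp
  \<comment> \<open>The minimiser would be \<open>- g / c\<close>; the denominator \<open>c + 1\<close> also covers \<open>c = 0\<close>.\<close>
  define s where "s = g / (c + 1)"
  have s: "g = s * (c + 1)" "s \<noteq> 0" using c g by (auto simp: s_def)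
  have "2 * (- s) * g + (- s)\<^sup>2 * c = - (s\<^sup>2 * (c + 2))"
    unfolding s(1) by (simp add: power2_eq_square algebra_simps)
  also have "\<dots> < 0" using s c by (simp add: mult_pos_pos)
  finally show False using assms[of "- s"] by simp
qed

text \<open>The variational description of the least eigenvalue. The quadratic form attains a minimum \<open>m\<close> on
  the unit sphere; by homogeneity \<open>m\<close> is a lower bound for its Rayleigh quotients, so the form of
  \<open>a - m I\<close> is nonnegative and vanishes at the minimiser. Moving the minimiser along a coordinate
  direction then shows that \<open>a - m I\<close> annihilates it.\<close>

lemma exists_least_eigenpair:
  fixes a :: "'v \<Rightarrow> 'v \<Rightarrow> real"
  assumes fin: "finite V" and ne: "V \<noteq> {}"
    and sym: "\<And>u v. u \<in> V \<Longrightarrow> v \<in> V \<Longrightarrow> a u v = a v u"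
  obtains m x where "\<exists>v\<in>V. x v \<noteq> 0" "\<And>u. u \<in> V \<Longrightarrow> (\<Sum>v\<in>V. a u v * x v) = m * x u"
    "\<And>y. m * (\<Sum>v\<in>V. (y v)\<^sup>2) \<le> bilin V a y y"
proof -
  define N where "N y = (\<Sum>v\<in>V. (y v)\<^sup>2)" for y :: "'v \<Rightarrow> real"
  \<comment> \<open>Vectors are functions on the whole type, with the product topology. The sphere is
    compact because it is a closed subset of a product of intervals; the coordinates outside \<open>V\<close>
    are pinned to \<open>0\<close>.\<close>
  define K where "K = PiE UNIV (\<lambda>v. if v \<in> V then {-1..1} else {0::real})"
  define S where "S = K \<inter> {y. N y = 1}"
  have K_iff: "y \<in> K \<longleftrightarrow> (\<forall>v. (v \<in> V \<longrightarrow> \<bar>y v\<bar> \<le> 1) \<and> (v \<notin> V \<longrightarrow> y v = 0))" for y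
    by (auto simp: K_def PiE_iff abs_le_iff split: if_splits)
  have "compactin (product_topology (\<lambda>i. euclidean) UNIV) K"
    unfolding K_def compactin_PiE by auto
  then have "compact K" by (simp add: euclidean_product_topology)
  moreover have contN: "continuous_on UNIV N"
    unfolding N_def by (intro continuous_intros continuous_on_product_coordinates)
  have "closed {y. N y = 1}"
    using contN continuous_on_const by (rule closed_Collect_eq)
  ultimately have "compact S" unfolding S_def by (rule compact_Int_closed)
  moreover obtain w where "w \<in> V" using ne by auto
  then have "(\<lambda>v. if v = w then 1 else 0) \<in> S"
    using fin by (auto simp: S_def K_iff N_def if_distrib[of "\<lambda>x. x\<^sup>2"] sum.delta cong: if_cong)
  then have "S \<noteq> {}" by auto
  moreover have "continuous_on S (\<lambda>y. bilin V a y y)"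
    unfolding bilin_def
    by (intro continuous_intros continuous_on_subset[OF continuous_on_product_coordinates]) auto
  ultimately obtain x where xS: "x \<in> S" and min: "\<And>y. y \<in> S \<Longrightarrow> bilin V a x x \<le> bilin V a y y"
    using continuous_attains_inf by (metis (no_types, lifting))
  define m where "m = bilin V a x x"
  have Nx: "N x = 1" using xS by (simp add: S_def)
  have le: "m * N y \<le> bilin V a y y" for y
  proof (cases "N y = 0")
    case True
    then have "y v = 0" if "v \<in> V" for v
      using that fin unfolding N_def by (subst (asm) sum_nonneg_eq_0_iff) auto
    then have "bilin V a y y = 0" by (simp add: bilin_def)
    then show ?thesis using True by simp
  next
    case False
    have "N y \<ge> 0" unfolding N_def by (intro sum_nonneg) auto
    with False have pos: "N y > 0" by simp
    define z where "z v = (if v \<in> V then y v / sqrt (N y) else 0)" for v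
    have "N z = (\<Sum>v\<in>V. (y v)\<^sup>2 / N y)"
      unfolding N_def z_def using pos
      by (intro sum.cong refl) (simp add: power_divide N_def[symmetric])
    also have "\<dots> = 1" using pos by (simp add: sum_divide_distrib[symmetric] N_def)
    finally have Nz: "N z = 1" .
    have "(z v)\<^sup>2 \<le> 1" if "v \<in> V" for v
      unfolding Nz[symmetric] N_def using that fin by (intro member_le_sum) auto
    then have "z \<in> S"
      using Nz by (auto simp: S_def K_iff abs_square_le_1 z_def)
    then have "m \<le> bilin V a z z" unfolding m_def by (rule min)
    also have "\<dots> = bilin V a (\<lambda>v. (1 / sqrt (N y)) * y v) (\<lambda>v. (1 / sqrt (N y)) * y v)"
      by (intro bilin_cong) (simp_all add: z_def)
    also have "\<dots> = bilin V a y y / N y"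
      using pos by (simp only: bilin_scale_left bilin_scale_right) simp
    finally show ?thesis using pos by (simp add: field_simps)
  qed
  have eig: "(\<Sum>v\<in>V. a u v * x v) = m * x u" if u: "u \<in> V" for u
  proof -
    let ?e = "\<lambda>v. if v = u then 1 else 0 :: real"
    define g where "g = (\<Sum>v\<in>V. a u v * x v)"
    have xe: "bilin V a x ?e = g"
      unfolding bilin_unit_right[OF fin u] g_def using sym u by (intro sum.cong refl) auto
    have ex: "bilin V a ?e x = g" using xe bilin_swap[of V a ?e x] sym by simp
    have "0 \<le> 2 * t * (g - m * x u) + t\<^sup>2 * (bilin V a ?e ?e - m)" for t
    proof -
      have "(\<Sum>v\<in>V. (x v + t * ?e v)\<^sup>2) = (\<Sum>v\<in>V. (x v)\<^sup>2 + (if v = u then 2 * t * x v + t\<^sup>2 else 0))"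
        by (intro sum.cong refl) (simp add: power2_eq_square algebra_simps)
      then have n: "N (\<lambda>v. x v + t * ?e v) = 1 + 2 * t * x u + t\<^sup>2"
        using Nx fin u by (simp add: N_def sum.distrib sum.delta)
      have "bilin V a (\<lambda>v. x v + t * ?e v) (\<lambda>v. x v + t * ?e v)
          = m + 2 * t * g + t\<^sup>2 * bilin V a ?e ?e"
        by (simp only: bilin_add_left bilin_add_right bilin_scale_left bilin_scale_right xe ex m_def)
          (simp add: power2_eq_square algebra_simps)
      then show ?thesis using le[of "\<lambda>v. x v + t * ?e v"] n by (simp add: algebra_simps)
    qed
    then have "g - m * x u = 0" by (rule linear_coeff_zero_if_nonneg)
    then show ?thesis by (simp add: g_def)
  qed
  have "\<exists>v\<in>V. x v \<noteq> 0" using Nx by (auto simp: N_def intro: ccontr)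
  then show thesis using eig le that unfolding N_def by blast
qed

text \<open>The minimum of the Rayleigh quotient is an eigenvalue, hence no smaller than the least one. In
  particular the real spectrum is nonempty, so that \<open>Min\<close> is meaningful.\<close>

lemma least_eigenvalue_rayleigh:
  fixes A :: "real mat"
  assumes A: "A \<in> carrier_mat n n" and n: "n > 0"
    and sym: "\<And>i j. i < n \<Longrightarrow> j < n \<Longrightarrow> A $$ (i, j) = A $$ (j, i)"
  shows "least_eigenvalue A * (\<Sum>i<n. (y i)\<^sup>2) \<le> bilin {..<n} (\<lambda>i j. A $$ (i, j)) y y"
proof -
  obtain m x where x: "\<exists>v\<in>{..<n}. x v \<noteq> 0"
    and eig: "\<And>u. u \<in> {..<n} \<Longrightarrow> (\<Sum>v\<in>{..<n}. A $$ (u, v) * x v) = m * x u"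
    and le: "\<And>y. m * (\<Sum>v\<in>{..<n}. (y v)\<^sup>2) \<le> bilin {..<n} (\<lambda>i j. A $$ (i, j)) y y"
  proof (rule exists_least_eigenpair[of "{..<n}" "\<lambda>i j. A $$ (i, j)"])
    show "{..<n} \<noteq> {}" using n by auto
  qed (use sym in auto)
  have "A *\<^sub>v vec n x = m \<cdot>\<^sub>v vec n x"
  proof (rule eq_vecI)
    fix i assume "i < dim_vec (m \<cdot>\<^sub>v vec n x)"
    then have i: "i < n" by simp
    have "(A *\<^sub>v vec n x) $ i = (\<Sum>j<n. A $$ (i, j) * x j)"
      using A i by (simp add: scalar_prod_def atLeast0LessThan)
    then show "(A *\<^sub>v vec n x) $ i = (m \<cdot>\<^sub>v vec n x) $ i" using eig i by simp
  qed (use A in simp)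
  moreover have "vec n x \<noteq> 0\<^sub>v n"
    using x by (metis index_vec index_zero_vec(1) lessThan_iff)
  ultimately have "eigenvector A (vec n x) m"
    using A by (auto simp: eigenvector_def)
  then have "m \<in> spectrum A" by (auto simp: spectrum_def eigenvalue_def)
  then have "least_eigenvalue A \<le> m"
    unfolding least_eigenvalue_def using card_finite_spectrum(1)[OF A] by simp
  then have "least_eigenvalue A * (\<Sum>i<n. (y i)\<^sup>2) \<le> m * (\<Sum>i<n. (y i)\<^sup>2)"
    by (intro mult_right_mono sum_nonneg) auto
  also note le
  finally show ?thesis .
qed

section \<open>The adjacency form of a graph\<close>

definition adj :: "'a ugraph \<Rightarrow> 'a \<Rightarrow> 'a \<Rightarrow> real" where
  "adj G u v = (if {u, v} \<in> edges G then 1 else 0)"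

lemma simple_graphD:
  assumes "simple_graph G" "{u, v} \<in> edges G"
  shows "u \<in> verts G" "v \<in> verts G" "u \<noteq> v"
  using assms by (auto simp: simple_graph_def)

lemma finite_edges: "simple_graph G \<Longrightarrow> finite (edges G)"
  by (rule finite_subset[of _ "Pow (verts G)"]) (auto simp: simple_graph_def)

lemma simple_graph_induced:
  "simple_graph G \<Longrightarrow> S \<subseteq> verts G \<Longrightarrow> simple_graph (induced G S)"
  by (auto simp: simple_graph_def induced_def intro: finite_subset)

lemma least_eigenvalue_adj_le:
  assumes vs: "distinct vs" "set vs = verts G" and ne: "verts G \<noteq> {}"
  shows "least_eigenvalue (adjacency_mat G vs) * (\<Sum>v\<in>verts G. (y v)\<^sup>2)
    \<le> bilin (verts G) (adj G) y y"
proof -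
  let ?n = "length vs" and ?A = "adjacency_mat G vs"
  have bij: "bij_betw ((!) vs) {..<?n} (verts G)" using vs by (simp add: bij_betw_nth)
  have A: "?A \<in> carrier_mat ?n ?n" by (simp add: adjacency_mat_def)
  have "?n > 0" using vs ne by auto
  then have "least_eigenvalue ?A * (\<Sum>i<?n. (y (vs ! i))\<^sup>2)
      \<le> bilin {..<?n} (\<lambda>i j. ?A $$ (i, j)) (\<lambda>i. y (vs ! i)) (\<lambda>i. y (vs ! i))"
    by (intro least_eigenvalue_rayleigh A) (auto simp: adjacency_mat_def insert_commute)
  also have "bilin {..<?n} (\<lambda>i j. ?A $$ (i, j)) (\<lambda>i. y (vs ! i)) (\<lambda>i. y (vs ! i))
      = (\<Sum>i<?n. \<Sum>j<?n. adj G (vs ! i) (vs ! j) * y (vs ! i) * y (vs ! j))"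
    unfolding bilin_def by (intro sum.cong refl) (simp add: adjacency_mat_def adj_def)
  also have "\<dots> = (\<Sum>i<?n. \<Sum>v\<in>verts G. adj G (vs ! i) v * y (vs ! i) * y v)"
    by (intro sum.cong refl sum.reindex_bij_betw[OF bij, where g = "\<lambda>v. adj G _ v * y _ * y v"])
  also have "\<dots> = bilin (verts G) (adj G) y y"
    unfolding bilin_def
    by (rule sum.reindex_bij_betw[OF bij, where g = "\<lambda>u. \<Sum>v\<in>verts G. adj G u v * y u * y v"])
  also have "(\<Sum>i<?n. (y (vs ! i))\<^sup>2) = (\<Sum>v\<in>verts G. (y v)\<^sup>2)"
    by (rule sum.reindex_bij_betw[OF bij, where g = "\<lambda>v. (y v)\<^sup>2"])
  finally show ?thesis .
qed

text \<open>There are no loops, so the form vanishes at every unit coordinate vector.\<close>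

lemma least_eigenvalue_adj_nonpos:
  assumes "simple_graph G" "distinct vs" "set vs = verts G" "verts G \<noteq> {}"
  shows "least_eigenvalue (adjacency_mat G vs) \<le> 0"
proof -
  obtain w where w: "w \<in> verts G" using assms(4) by auto
  have fin: "finite (verts G)" using assms(1) by (simp add: simple_graph_def)
  have "adj G w w = 0" using simple_graphD(3)[OF assms(1), of w w] by (auto simp: adj_def)
  then have "bilin (verts G) (adj G) (\<lambda>v. if v = w then 1 else 0) (\<lambda>v. if v = w then 1 else 0) = 0"
    unfolding bilin_unit_right[OF fin w] by (intro sum.neutral) auto
  moreover have "(\<Sum>v\<in>verts G. (if v = w then 1 else 0 :: real)\<^sup>2) = 1"
    using fin w by (simp add: if_distrib[of "\<lambda>x. x\<^sup>2"] sum.delta cong: if_cong)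
  ultimately show ?thesis
    using least_eigenvalue_adj_le[OF assms(2-4), of "\<lambda>v. if v = w then 1 else 0"] by simp
qed

lemma bilin_adj_one:
  assumes G: "simple_graph G"
  shows "bilin (verts G) (adj G) (\<lambda>_. 1) (\<lambda>_. 1) = average_degree G * real (card (verts G))"
proof -
  have fin: "finite (verts G)" using G by (simp add: simple_graph_def)
  have "(\<Sum>v\<in>verts G. adj G u v) = real (vertex_degree G u)" for u
  proof -
    have "{e \<in> edges G. u \<in> e} = (\<lambda>v. {u, v}) ` {v \<in> verts G. {u, v} \<in> edges G}"
    proof (intro equalityI subsetI)
      fix e assume "e \<in> {e \<in> edges G. u \<in> e}"
      then have e: "e \<in> edges G" "u \<in> e" by auto
      then have "card e = 2" using G by (auto simp: simple_graph_def)
      then obtain v where "e = {u, v}" using e(2) by (auto simp: card_2_iff)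
      with e show "e \<in> (\<lambda>v. {u, v}) ` {v \<in> verts G. {u, v} \<in> edges G}"
        using simple_graphD[OF G] by auto
    qed auto
    moreover have "inj (\<lambda>v. {u, v})" by (auto simp: inj_def doubleton_eq_iff)
    ultimately have "vertex_degree G u = card {v \<in> verts G. {u, v} \<in> edges G}"
      unfolding vertex_degree_def by (simp add: card_image inj_on_subset)
    then show ?thesis using fin by (simp add: adj_def sum.If_cases Int_def)
  qed
  then show ?thesis
    using fin by (cases "verts G = {}") (simp_all add: bilin_def average_degree_def)
qed

text \<open>Each edge \<open>uv\<close> inside \<open>S\<close> lies in a class \<open>E w\<close> of the cover with \<open>w \<in> {u, v}\<close>, and its weight
  \<open>f u * f v\<close> is at most \<open>t * f w\<close>. A vertex \<open>w\<close> pays for at most \<open>c\<close> edges; the factor \<open>2\<close> arises because the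
  form counts every edge in both directions.\<close>

lemma bilin_adj_vertex_cover_le:
  assumes G: "simple_graph G" and S: "S \<subseteq> verts G"
    and cov: "has_vertex_cover c (induced G S)"
    and f0: "\<And>v. v \<notin> S \<Longrightarrow> f v = 0" and f: "\<And>v. v \<in> S \<Longrightarrow> 0 \<le> f v" "\<And>v. v \<in> S \<Longrightarrow> f v \<le> t"
  shows "bilin (verts G) (adj G) f f \<le> 2 * (c * t) * (\<Sum>v\<in>S. f v)"
proof -
  let ?H = "induced G S"
  have H: "simple_graph ?H" using simple_graph_induced G S by blast
  have fin: "finite (verts G)" using G by (simp add: simple_graph_def)
  have finS: "finite S" using fin S by (rule finite_subset[rotated])
  obtain E where E: "edges ?H = (\<Union>i\<in>S. E i)"
    and Ei: "\<And>i. i \<in> S \<Longrightarrow> E i \<subseteq> {e \<in> edges ?H. i \<in> e}" "\<And>i. i \<in> S \<Longrightarrow> real (card (E i)) \<le> c"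
    using cov unfolding has_vertex_cover_def by (metis select_convs(1) induced_def)
  have "bilin (verts G) (adj G) f f = (\<Sum>u\<in>S. \<Sum>v\<in>S. adj G u v * f u * f v)"
  proof -
    have "(\<Sum>v\<in>verts G. adj G u v * f u * f v) = (\<Sum>v\<in>S. adj G u v * f u * f v)" for u
      using fin S f0 by (intro sum.mono_neutral_right) auto
    moreover have "(\<Sum>u\<in>verts G. \<Sum>v\<in>S. adj G u v * f u * f v) = (\<Sum>u\<in>S. \<Sum>v\<in>S. adj G u v * f u * f v)"
      using fin S f0 by (intro sum.mono_neutral_right) auto
    ultimately show ?thesis by (simp add: bilin_def)
  qed
  also have "\<dots> \<le> (\<Sum>u\<in>S. \<Sum>v\<in>S. (if {u, v} \<in> E u then t * f u else 0) + (if {v, u} \<in> E v then t * f v else 0))"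
  proof (intro sum_mono)
    fix u v assume uv: "u \<in> S" "v \<in> S"
    have nn: "0 \<le> t * f u" "0 \<le> t * f v" using f uv order_trans[OF f(1,2)] by auto
    show "adj G u v * f u * f v
      \<le> (if {u, v} \<in> E u then t * f u else 0) + (if {v, u} \<in> E v then t * f v else 0)"
    proof (cases "{u, v} \<in> edges G")
      case True
      then have "{u, v} \<in> edges ?H" using uv by (simp add: induced_def)
      then obtain w where w: "w \<in> S" "{u, v} \<in> E w" using E by auto
      then have "w = u \<or> w = v" using Ei(1) by blast
      moreover have "f u * f v \<le> t * f v" using f uv by (intro mult_right_mono) auto
      moreover have "f v * f u \<le> t * f u" using f uv by (intro mult_right_mono) auto
      then have "f u * f v \<le> t * f u" by (simp add: mult.commute)
      ultimately show ?thesis using w nn True by (auto simp: adj_def insert_commute)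
    qed (use nn in \<open>simp add: adj_def\<close>)
  qed
  also have "\<dots> = 2 * (\<Sum>u\<in>S. \<Sum>v\<in>S. if {u, v} \<in> E u then t * f u else 0)"
    using sum.swap[of "\<lambda>u v. if {v, u} \<in> E v then t * f v else 0" S S]
    by (simp add: sum.distrib)
  also have "\<dots> \<le> 2 * (\<Sum>u\<in>S. c * (t * f u))"
  proof (intro mult_left_mono sum_mono)
    fix u assume u: "u \<in> S"
    have nn: "0 \<le> t * f u" using f u order_trans[OF f(1,2)] by auto
    have "finite (E u)" using Ei(1)[OF u] finite_edges[OF H] by (auto intro: finite_subset)
    moreover have "inj (\<lambda>v. {u, v})" by (auto simp: inj_def doubleton_eq_iff)
    ultimately have "card {v \<in> S. {u, v} \<in> E u} \<le> card (E u)"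
      by (intro card_inj_on_le[of "\<lambda>v. {u, v}"]) (auto intro: inj_on_subset)
    then have "real (card {v \<in> S. {u, v} \<in> E u}) \<le> c" using Ei(2)[OF u] by linarith
    then have "real (card {v \<in> S. {u, v} \<in> E u}) * (t * f u) \<le> c * (t * f u)"
      using nn by (rule mult_right_mono)
    then show "(\<Sum>v\<in>S. if {u, v} \<in> E u then t * f u else 0) \<le> c * (t * f u)"
      using finS by (simp add: sum.If_cases Int_def)
  qed simp
  also have "\<dots> = 2 * (c * t) * (\<Sum>v\<in>S. f v)" by (simp add: sum_distrib_left mult.assoc)
  finally show ?thesis .
qed

section \<open>Covers by weighted induced subgraphs\<close>

lemma chromatic_number_pos:
  assumes H: "simple_graph H" and ne: "verts H \<noteq> {}"
  shows "chromatic_number H \<ge> 1"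
proof -
  have "finite (verts H)" using H by (simp add: simple_graph_def)
  then obtain c :: "'a \<Rightarrow> nat" and k where c: "c ` verts H = {i. i < k}" "inj_on c (verts H)"
    using finite_imp_inj_to_nat_seg[of "verts H"] by blast
  have "c u \<noteq> c v" if "{u, v} \<in> edges H" for u v
    using simple_graphD[OF H that] c(2) by (simp add: inj_on_eq_iff)
  then have "proper_colouring H k c"
    unfolding proper_colouring_def using c(1) by auto
  then have "\<exists>c. proper_colouring H (chromatic_number H) c"
    unfolding chromatic_number_def by (intro LeastI[where P = "\<lambda>k. \<exists>c. proper_colouring H k c"] exI)
  then show ?thesis using ne by (force simp: proper_colouring_def)
qed

lemma graph_parameter_ge_1:
  assumes "\<And>H. simple_graph H \<Longrightarrow> edges H = {} \<Longrightarrow> \<psi> H = 1"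
    and "\<And>H. simple_graph H \<Longrightarrow> \<psi> H \<ge> real (chromatic_number H)"
    and H: "simple_graph H"
  shows "\<psi> H \<ge> 1"
proof (cases "verts H = {}")
  case True
  then have "edges H = {}" using H by (auto simp: simple_graph_def)
  then show ?thesis using assms(1) H by simp
next
  case False
  then show ?thesis using chromatic_number_pos[OF H] assms(2)[OF H] by linarith
qed

text \<open>The families over which \<open>L\<close> minimises the size \<open>k\<close>.\<close>

definition cover_family :: "('a ugraph \<Rightarrow> real) \<Rightarrow> real \<Rightarrow> 'a ugraph \<Rightarrow> nat \<Rightarrow> (nat \<Rightarrow> 'a set) \<Rightarrow> bool" where
  "cover_family \<psi> \<alpha> G k S \<longleftrightarrow>
      (\<forall>i<k. S i \<subseteq> verts G \<and> has_vertex_cover (\<alpha> * \<psi> (induced G (S i))) (induced G (S i))) \<and>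
      (\<forall>v\<in>verts G. (\<Sum>i | i < k \<and> v \<in> S i. 1 / \<psi> (induced G (S i))) \<ge> 1)"

text \<open>Some family exists, so the least size in the definition of \<open>L\<close> is attained.\<close>

lemma cover_family_singletons:
  assumes one: "\<And>H. simple_graph H \<Longrightarrow> edges H = {} \<Longrightarrow> \<psi> H = 1"
    and "\<alpha> \<ge> 0" and G: "simple_graph G" and vs: "set vs = verts G"
  shows "cover_family \<psi> \<alpha> G (length vs) (\<lambda>i. {vs ! i})"
proof -
  have edgeless: "edges (induced G {v}) = {}" if "v \<in> verts G" for v
  proof -
    have False if "e \<in> edges G" "e \<subseteq> {v}" for e
    proof -
      have "card e = 2" using that G by (auto simp: simple_graph_def)
      moreover have "card e \<le> 1" using that card_mono[of "{v}" e] by simp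
      ultimately show False by simp
    qed
    then show ?thesis by (auto simp: induced_def)
  qed
  have psi: "\<psi> (induced G {v}) = 1" if "v \<in> verts G" for v
    using one[OF simple_graph_induced edgeless] G that by auto
  have "has_vertex_cover \<alpha> (induced G {v})" if "v \<in> verts G" for v
    unfolding has_vertex_cover_def edgeless[OF that]
    using \<open>\<alpha> \<ge> 0\<close> by (intro exI[of _ "\<lambda>_. {}"]) auto
  moreover have "1 \<le> (\<Sum>i | i < length vs \<and> v \<in> {vs ! i}. 1 / \<psi> (induced G {vs ! i}))"
    if v: "v \<in> verts G" for v
  proof -
    obtain i where i: "i < length vs" "vs ! i = v" using v vs by (metis in_set_conv_nth)
    have "1 / \<psi> (induced G {vs ! i}) \<le> (\<Sum>i | i < length vs \<and> v \<in> {vs ! i}. 1 / \<psi> (induced G {vs ! i}))"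
      using i v psi by (intro member_le_sum) auto
    then show ?thesis using i psi v by simp
  qed
  moreover have "vs ! i \<in> verts G" if "i < length vs" for i
    using nth_mem[OF that] vs by simp
  ultimately show ?thesis unfolding cover_family_def by (simp add: psi)
qed

text \<open>Shrinking the sets until the sums are exactly \<open>1\<close> would change the values of \<open>\<psi>\<close> in an
  uncontrolled way. The sets are therefore kept and only the weights of their vertices are reduced.\<close>

lemma cover_family_weights:
  assumes fam: "cover_family \<psi> \<alpha> G k S"
    and psi: "\<And>i. i < k \<Longrightarrow> \<psi> (induced G (S i)) > 0"
  obtains f where "\<And>i v. i < k \<Longrightarrow> 0 \<le> f i v" "\<And>i v. i < k \<Longrightarrow> v \<notin> S i \<Longrightarrow> f i v = 0"
    "\<And>i v. i < k \<Longrightarrow> v \<in> S i \<Longrightarrow> f i v \<le> 1 / \<psi> (induced G (S i))"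
    "\<And>v. v \<in> verts G \<Longrightarrow> (\<Sum>i<k. f i v) = 1"
proof -
  define g where "g i v = (if v \<in> S i then 1 / \<psi> (induced G (S i)) else 0)" for i v
  define s where "s v = (\<Sum>i<k. g i v)" for v
  have g: "0 \<le> g i v" if "i < k" for i v using psi[OF that] by (simp add: g_def)
  have s: "s v \<ge> 1" if "v \<in> verts G" for v
  proof -
    have "s v = (\<Sum>i | i < k \<and> v \<in> S i. 1 / \<psi> (induced G (S i)))"
      unfolding s_def g_def by (simp add: sum.If_cases Int_def)
    then show ?thesis using fam that by (simp add: cover_family_def)
  qed
  have S: "v \<in> verts G" if "i < k" "v \<in> S i" for i v
    using fam that by (auto simp: cover_family_def)
  show thesis
  proof (rule that[of "\<lambda>i v. g i v / s v"])
    show "0 \<le> g i v / s v" if "i < k" for i v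
      using g that by (auto simp: s_def intro!: divide_nonneg_nonneg sum_nonneg)
    show "g i v / s v = 0" if "v \<notin> S i" for i v using that by (simp add: g_def)
    show "g i v / s v \<le> 1 / \<psi> (induced G (S i))" if "i < k" "v \<in> S i" for i v
    proof -
      have "g i v / s v \<le> g i v" using g[of i v] s[OF S[OF that]] that(1)
        by (simp add: divide_le_eq mult_le_cancel_left1)
      then show ?thesis using that by (simp add: g_def)
    qed
    show "(\<Sum>i<k. g i v / s v) = 1" if "v \<in> verts G" for v
      using s[OF that] by (simp add: sum_divide_distrib[symmetric] s_def[symmetric])
  qed
qed

text \<open>The counting argument, with any nonpositive lower bound \<open>lam\<close> for the Rayleigh quotients of the
  adjacency form in place of the least eigenvalue. The form \<open>b\<close> in the proof is that of \<open>A - lam I\<close>.\<close>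

lemma cover_family_size_ge:
  assumes psi: "\<And>H. simple_graph H \<Longrightarrow> \<psi> H \<ge> 1"
    and G: "simple_graph G" and ne: "verts G \<noteq> {}"
    and lam: "\<And>y. lam * (\<Sum>v\<in>verts G. (y v)\<^sup>2) \<le> bilin (verts G) (adj G) y y" and neg: "lam \<le> 0"
    and fam: "cover_family \<psi> \<alpha> G k S"
  shows "average_degree G - lam \<le> real k * (2 * \<alpha> - lam)"
proof -
  let ?V = "verts G" and ?p = "\<lambda>i. \<psi> (induced G (S i))"
  define n where "n = real (card ?V)"
  have fin: "finite ?V" using G by (simp add: simple_graph_def)
  then have n: "n > 0" using ne by (simp add: n_def card_gt_0_iff)
  have S: "S i \<subseteq> ?V" "has_vertex_cover (\<alpha> * ?p i) (induced G (S i))" if "i < k" for i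
    using fam that by (auto simp: cover_family_def)
  have p: "?p i \<ge> 1" if "i < k" for i using psi simple_graph_induced[OF G S(1)[OF that]] .
  obtain f where f: "\<And>i v. i < k \<Longrightarrow> 0 \<le> f i v" "\<And>i v. i < k \<Longrightarrow> v \<notin> S i \<Longrightarrow> f i v = 0"
    "\<And>i v. i < k \<Longrightarrow> v \<in> S i \<Longrightarrow> f i v \<le> 1 / ?p i"
    and f1: "\<And>v. v \<in> ?V \<Longrightarrow> (\<Sum>i<k. f i v) = 1"
  proof (rule cover_family_weights[OF fam])
    show "?p i > 0" if "i < k" for i using p[OF that] by simp
  qed blast
  define b where "b u v = adj G u v - (if u = v then lam else 0)" for u v
  have b: "bilin ?V b y y = bilin ?V (adj G) y y - lam * (\<Sum>v\<in>?V. (y v)\<^sup>2)" for y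
    unfolding b_def using fin by (rule bilin_shift)
  have each: "bilin ?V b (f i) (f i) \<le> (2 * \<alpha> - lam) * (\<Sum>v\<in>?V. f i v)" if i: "i < k" for i
  proof -
    have sumS: "(\<Sum>v\<in>S i. f i v) = (\<Sum>v\<in>?V. f i v)"
      using fin S(1)[OF i] f(2)[OF i] by (intro sum.mono_neutral_left) auto
    have "bilin ?V (adj G) (f i) (f i) \<le> 2 * ((\<alpha> * ?p i) * (1 / ?p i)) * (\<Sum>v\<in>S i. f i v)"
      using f[OF i] by (intro bilin_adj_vertex_cover_le[OF G S[OF i]])
    also have "\<dots> = 2 * \<alpha> * (\<Sum>v\<in>?V. f i v)" using p[OF i] sumS by simp
    finally have 1: "bilin ?V (adj G) (f i) (f i) \<le> 2 * \<alpha> * (\<Sum>v\<in>?V. f i v)" .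
    have "(\<Sum>v\<in>?V. (f i v)\<^sup>2) \<le> (\<Sum>v\<in>?V. f i v)"
    proof (rule sum_mono)
      fix v
      have "1 / ?p i \<le> 1" using p[OF i] by simp
      then have "f i v \<le> 1" using f(2,3)[OF i, of v] by (cases "v \<in> S i") auto
      then show "(f i v)\<^sup>2 \<le> f i v"
        using f(1)[OF i, of v] by (simp add: power2_eq_square mult_left_le)
    qed
    then have "(- lam) * (\<Sum>v\<in>?V. (f i v)\<^sup>2) \<le> (- lam) * (\<Sum>v\<in>?V. f i v)"
      using neg by (intro mult_left_mono) auto
    with 1 show ?thesis by (simp add: b algebra_simps)
  qed
  have "(average_degree G - lam) * n = bilin ?V b (\<lambda>_. 1) (\<lambda>_. 1)"
    by (simp add: b bilin_adj_one[OF G] n_def algebra_simps)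
  also have "\<dots> = bilin ?V b (\<lambda>v. \<Sum>i<k. f i v) (\<lambda>v. \<Sum>i<k. f i v)"
    by (intro bilin_cong) (simp_all add: f1)
  also have "\<dots> \<le> real (card {..<k}) * (\<Sum>i<k. bilin ?V b (f i) (f i))"
    by (intro bilin_psd_sum_le) (use lam in \<open>simp add: b\<close>)
  also have "\<dots> \<le> real k * (\<Sum>i<k. (2 * \<alpha> - lam) * (\<Sum>v\<in>?V. f i v))"
    using each by (auto intro!: mult_left_mono sum_mono)
  also have "\<dots> = real k * ((2 * \<alpha> - lam) * (\<Sum>v\<in>?V. \<Sum>i<k. f i v))"
    by (subst sum.swap) (simp add: sum_distrib_left)
  also have "(\<Sum>v\<in>?V. \<Sum>i<k. f i v) = n" by (simp add: f1 n_def)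
  finally have "(average_degree G - lam) * n \<le> real k * (2 * \<alpha> - lam) * n" by (simp add: mult_ac)
  then show ?thesis using n by simp
qed

section \<open>The lower bound\<close>

theorem theorem2:
  fixes \<psi> :: "'a ugraph \<Rightarrow> real" and \<alpha> :: real and G :: "'a ugraph" and vs :: "'a list"
  assumes "graph_parameter \<psi>"
    and "\<And>H. simple_graph H \<Longrightarrow> edges H = {} \<Longrightarrow> \<psi> H = 1"
    and "\<And>H. simple_graph H \<Longrightarrow> \<psi> H \<ge> real (chromatic_number H)"
    and "\<alpha> \<ge> 0"
    and "simple_graph G" and "verts G \<noteq> {}"
    and "distinct vs" and "set vs = verts G"
  shows "real (L \<psi> \<alpha> G) \<ge>
    (average_degree G - least_eigenvalue (adjacency_mat G vs)) /
    (2 * \<alpha> - least_eigenvalue (adjacency_mat G vs))"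
proof -
  let ?lam = "least_eigenvalue (adjacency_mat G vs)"
  have L: "L \<psi> \<alpha> G = (LEAST k. \<exists>S. cover_family \<psi> \<alpha> G k S)"
    by (simp add: L_def cover_family_def)
  have "\<exists>k S. cover_family \<psi> \<alpha> G k S"
    using cover_family_singletons[of \<psi> \<alpha> G vs] assms by blast
  then have "\<exists>S. cover_family \<psi> \<alpha> G (L \<psi> \<alpha> G) S"
    unfolding L by (rule LeastI_ex)
  then obtain S where "cover_family \<psi> \<alpha> G (L \<psi> \<alpha> G) S" by blast
  moreover have neg: "?lam \<le> 0" using least_eigenvalue_adj_nonpos assms by blast
  ultimately have le: "average_degree G - ?lam \<le> real (L \<psi> \<alpha> G) * (2 * \<alpha> - ?lam)"
    using assms graph_parameter_ge_1[of \<psi>]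
    by (intro cover_family_size_ge least_eigenvalue_adj_le) auto
  \<comment> \<open>If the denominator is \<open>0\<close>, then so is the quotient.\<close>
  show ?thesis
  proof (cases "2 * \<alpha> - ?lam = 0")
    case False
    then have "2 * \<alpha> - ?lam > 0" using neg \<open>\<alpha> \<ge> 0\<close> by simp
    then show ?thesis using le by (simp add: pos_divide_le_eq)
  qed simp
qed

end
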